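(* Let $d,m\in\mathbb{N}$ and, for each $i=1,2,\dots,m$, let $F_i$ be a finite set of polynomial maps $f:(\mathbb{Z}^d)^i\to\mathbb{Z}^d$ such that $f(\mathbf{0})=\mathbf{0}$. Let $\vec F=(F_1,\dots,F_m)$ and let $c:\mathbb{Z}^d\to\mathbb{Z}^d$ be a scalar homomorphism, i.e. $c(x_1,\dots,x_d)=(ax_1,\dots,ax_d)$ for some $a\in\mathbb{Z}\setminus\{0\}$. Then for any finite coloring of $\mathbb{Z}^d$ there exists $\mathbf{s}\in(\mathbb{Z}^d\setminus\{0\})^{m+1}$ such that the set $D(m,\vec F,c;\mathbf{s})$ is monochromatic.
   Context: $\mathbb{N}=\{1,2,\dots\}$. A polynomial map $(\mathbb{Z}^d)^i\to\mathbb{Z}^d$ is a map each of whose $d$ coordinates is given by a polynomial in the $id$ integer variables (taking integer values). For $\mathbf{s}=(s_0,\dots,s_m)\in(\mathbb{Z}^d\setminus\{0\})^{m+1}$, $$D(m,\vec F,c;\mathbf{s})=\{c(s_0)\}\cup\bigcup_{i=1}^m\{f(s_0,\dots,s_{i-1})+c(s_i): f\in F_i\}\subset\mathbb{Z}^d.$$ *)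

theory Defs
  imports "HOL-Analysis.Analysis" "HOL-Library.Poly_Mapping"
begin

(* Multivariate polynomials over 'a with variables in 'v are finitely supported functions from
   exponent vectors 'v =>0 nat to coefficients. *)

type_synonym ('v, 'a) mpolynomial = "('v \<Rightarrow>\<^sub>0 nat) \<Rightarrow>\<^sub>0 'a"

definition mpoly_vars :: "('v, 'a::zero) mpolynomial \<Rightarrow> 'v set" where
  "mpoly_vars p = (\<Union>e\<in>Poly_Mapping.keys p. Poly_Mapping.keys e)"

definition mpoly_eval :: "('v, 'a::comm_semiring_1) mpolynomial \<Rightarrow> ('v \<Rightarrow> 'a) \<Rightarrow> 'a" where
  "mpoly_eval p x = (\<Sum>e\<in>Poly_Mapping.keys p.
     Poly_Mapping.lookup p e * (\<Prod>v\<in>Poly_Mapping.keys e. x v ^ Poly_Mapping.lookup e v))"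

(* Z^d is int ^ 'd with d = CARD('d) >= 1.  A map (Z^d)^i -> Z^d is encoded as a map on sequences
   (nat => int ^ 'd) that only uses the entries 0, ..., i - 1.  For polynomial maps this is
   enforced by the restriction on the variables: (j, l) stands for the l-th coordinate of the
   j-th argument.  A polynomial with integer values at integer points need not have integer
   coefficients (as x (x - 1) / 2 shows), but its coefficients are always rational. *)

definition polynomial_map :: "nat \<Rightarrow> ((nat \<Rightarrow> int ^ 'd::finite) \<Rightarrow> int ^ 'd) \<Rightarrow> bool" where
  "polynomial_map i f \<longleftrightarrow>
     (\<forall>k. \<exists>p :: (nat \<times> 'd, rat) mpolynomial.
        mpoly_vars p \<subseteq> {..<i} \<times> UNIV \<and>
        (\<forall>s. of_int (f s $ k) = mpoly_eval p (\<lambda>(j, l). of_int (s j $ l))))"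

definition scalar_hom :: "(int ^ 'd::finite \<Rightarrow> int ^ 'd) \<Rightarrow> bool" where
  "scalar_hom c \<longleftrightarrow> (\<exists>a. a \<noteq> 0 \<and> (\<forall>x. c x = a *s x))"

(* With the encoding above, f s is f(s_0, ..., s_{i-1}) for f in F i. *)

definition deuber_set :: "nat \<Rightarrow> (nat \<Rightarrow> ((nat \<Rightarrow> int ^ 'd::finite) \<Rightarrow> int ^ 'd) set)
    \<Rightarrow> (int ^ 'd \<Rightarrow> int ^ 'd) \<Rightarrow> (nat \<Rightarrow> int ^ 'd) \<Rightarrow> (int ^ 'd) set" where
  "deuber_set m F c s = {c (s 0)} \<union> (\<Union>i\<in>{1..m}. {f s + c (s i) | f. f \<in> F i})"

definition monochromatic :: "('a \<Rightarrow> 'col) \<Rightarrow> 'a set \<Rightarrow> bool" where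
  "monochromatic col A \<longleftrightarrow> (\<exists>k. \<forall>x\<in>A. col x = k)"

end

theory Submission
  imports Defs "HOL-Library.Function_Algebras"
begin

text \<open>
  It suffices to find \<open>s\<close> for which each row \<open>{f s + a s\<^sub>i | f}\<close> is monochromatic, with colours that may
  depend on the row: among sufficiently many rows, \<open>m + 1\<close> have the same colour, and the corresponding
  subsequence of \<open>s\<close> solves the problem if the families of the long system contain all \<open>F\<^sub>j\<close> read along
  subsequences.

  The rows are treated from the last one to the first. So that the induction closes up, each \<open>s\<^sub>i\<close> is
  a polynomial function of an auxiliary parameter \<open>n\<close>, vanishing at 0, and there is a finite set of
  candidates that serves all \<open>n \<ge> 1\<close> and all colourings with \<open>r\<close> colours. The polynomial van der Waerden
  theorem, applied in the group of such functions to \<open>k \<mapsto> (n \<mapsto> f(s(k n)))\<close>, where \<open>s\<close> ranges over the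
  candidates for the preceding rows, gives the last entry together with a dilation factor \<open>k\<close>; the
  preceding rows are then taken at the parameter \<open>k n\<close>.
\<close>

section \<open>Polynomial sequences in abelian groups\<close>

text \<open>\<open>dpoly e p\<close> says that \<open>p\<close> is a polynomial of degree less than \<open>e\<close>.\<close>

primrec dpoly :: "nat \<Rightarrow> (nat \<Rightarrow> 'a::ab_group_add) \<Rightarrow> bool" where
  "dpoly 0 p \<longleftrightarrow> (\<forall>k. p k = 0)"
| "dpoly (Suc e) p \<longleftrightarrow> (\<forall>h. dpoly e (\<lambda>k. p (k + h) - p k))"

lemma dpoly_zero: "dpoly e (\<lambda>k. 0)"
  by (induction e) auto

lemma dpoly_mono_Suc: "dpoly e p \<Longrightarrow> dpoly (Suc e) p"
proof (induction e arbitrary: p)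
  case 0
  then show ?case by simp
next
  case (Suc e)
  have "dpoly (Suc e) (\<lambda>k. p (k + h) - p k)" for h
    using Suc.prems by (intro Suc.IH) simp
  then show ?case unfolding dpoly.simps(2)[of "Suc e"] by blast
qed

lemma dpoly_mono:
  assumes "dpoly e p" "e \<le> e'" shows "dpoly e' p"
  using assms(2,1) by (induction rule: dec_induct) (blast intro: dpoly_mono_Suc)+

lemma dpoly_add: "dpoly e p \<Longrightarrow> dpoly e q \<Longrightarrow> dpoly e (\<lambda>k. p k + q k)"
proof (induction e arbitrary: p q)
  case (Suc e)
  have "dpoly e (\<lambda>k. (p (k + h) - p k) + (q (k + h) - q k))" for h
    using Suc by auto
  then show ?case by (simp add: add_diff_add)
qed auto

lemma dpoly_minus: "dpoly e p \<Longrightarrow> dpoly e (\<lambda>k. - p k)"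
proof (induction e arbitrary: p)
  case (Suc e)
  have "dpoly e (\<lambda>k. - (p (k + h) - p k))" for h
    using Suc.IH Suc.prems unfolding dpoly.simps by blast
  then show ?case by simp
qed auto

lemma dpoly_diff: "dpoly e p \<Longrightarrow> dpoly e q \<Longrightarrow> dpoly e (\<lambda>k. p k - q k)"
  using dpoly_add[of e p "\<lambda>k. - q k"] dpoly_minus[of e q] by simp

lemma dpoly_const: "dpoly (Suc e) (\<lambda>k. a)"
  by (simp add: dpoly_zero)

text \<open>Leibniz rule for differences: the difference of the product splits into three products,
  each with at least one factor replaced by its difference. In each the index sum has dropped, so
  induction on \<open>d + e\<close> applies.\<close>

lemma dpoly_mult:
  fixes p q :: "nat \<Rightarrow> 'a::comm_ring"
  shows "dpoly d p \<Longrightarrow> dpoly e q \<Longrightarrow> dpoly (d + e) (\<lambda>k. p k * q k)"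
proof (induction "d + e" arbitrary: d e p q)
  case 0
  then show ?case by simp
next
  case (Suc n)
  show ?case
  proof (cases "d = 0 \<or> e = 0")
    case True
    then have "(\<lambda>k. p k * q k) = (\<lambda>k. 0)" using Suc.prems by auto
    then show ?thesis by (simp only: dpoly_zero)
  next
    case False
    then obtain d' e' where de: "d = Suc d'" "e = Suc e'" by (metis not0_implies_Suc)
    have "dpoly n (\<lambda>k. p (k + h) * q (k + h) - p k * q k)" for h
    proof -
      let ?p = "\<lambda>k. p (k + h) - p k" and ?q = "\<lambda>k. q (k + h) - q k"
      have p: "dpoly d' ?p" and q: "dpoly e' ?q" using Suc.prems de by auto
      have "dpoly n (\<lambda>k. ?p k * q k)" "dpoly n (\<lambda>k. p k * ?q k)"
        using Suc.hyps(1)[OF _ p Suc.prems(2)] Suc.hyps(1)[OF _ Suc.prems(1) q] Suc.hyps(2) de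
        by auto
      moreover have "dpoly n (\<lambda>k. ?p k * ?q k)"
        using Suc.hyps(1)[OF _ dpoly_mono_Suc[OF p] q] Suc.hyps(2) de by auto
      ultimately have "dpoly n (\<lambda>k. ?p k * q k + p k * ?q k + ?p k * ?q k)"
        by (intro dpoly_add)
      then show ?thesis by (simp add: algebra_simps)
    qed
    then show ?thesis unfolding Suc.hyps(2)[symmetric] by simp
  qed
qed

lemma dpoly_dilate: "dpoly e p \<Longrightarrow> dpoly e (\<lambda>k. p (k * n))"
proof (induction e arbitrary: p)
  case (Suc e)
  have "dpoly e (\<lambda>k. p (k * n + h * n) - p (k * n))" for h
    using Suc.IH[of "\<lambda>k. p (k + h * n) - p k"] Suc.prems by simp
  then show ?case by (simp add: algebra_simps)
qed auto

lemma dpoly_pointwise: "dpoly e p \<longleftrightarrow> (\<forall>n. dpoly e (\<lambda>k. p k n))"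
  by (induction e arbitrary: p) (auto simp: fun_eq_iff)

text \<open>Differences commute with \<open>g\<close>, and injectivity gives the converse at the
  bottom. This serves to divide a sequence by \<open>a\<close> and to return from rational to
  integer values.\<close>

lemma dpoly_additive_iff:
  assumes "\<And>x y. g (x - y) = g x - g y" "\<And>x. g x = 0 \<longleftrightarrow> x = 0"
  shows "dpoly e (\<lambda>k. g (p k)) \<longleftrightarrow> dpoly e p"
proof (induction e arbitrary: p)
  case 0
  then show ?case by (simp add: assms)
next
  case (Suc e)
  show ?case by (simp add: Suc assms(1)[symmetric])
qed

lemma dpoly_vec: "dpoly e p \<longleftrightarrow> (\<forall>l. dpoly e (\<lambda>k. p k $ l))"
  by (induction e arbitrary: p) (auto simp: vec_eq_iff)

section \<open>The polynomial van der Waerden theorem\<close>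

text \<open>A subset rather than a type: the theorem will be applied to \<open>polys\<close> inside
  the group of all functions, and the base points must again be polynomial.\<close>

definition add_subgroup :: "'a::ab_group_add set \<Rightarrow> bool" where
  "add_subgroup B \<longleftrightarrow> 0 \<in> B \<and> (\<forall>x\<in>B. \<forall>y\<in>B. x + y \<in> B \<and> x - y \<in> B)"

lemma add_subgroup_add: "add_subgroup B \<Longrightarrow> x \<in> B \<Longrightarrow> y \<in> B \<Longrightarrow> x + y \<in> B"
  by (simp add: add_subgroup_def)

lemma add_subgroup_diff: "add_subgroup B \<Longrightarrow> x \<in> B \<Longrightarrow> y \<in> B \<Longrightarrow> x - y \<in> B"
  by (simp add: add_subgroup_def)

text \<open>The finitary form, uniform in the colouring. Focusing needs it for finite windows, and
  it later yields candidates that do not depend on the parameter \<open>n\<close>.\<close>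

definition vdw :: "'a::ab_group_add set \<Rightarrow> (nat \<Rightarrow> 'a) set \<Rightarrow> bool" where
  "vdw B P \<longleftrightarrow> (\<forall>r. \<exists>X K. finite X \<and> X \<subseteq> B \<and>
     (\<forall>col :: 'a \<Rightarrow> nat. (\<forall>v. col v < r) \<longrightarrow>
        (\<exists>x\<in>X. \<exists>k\<in>{1..K}. \<forall>p\<in>P. col (x + p k) = col x)))"

text \<open>Used with colours that are themselves colour patterns on a finite window.\<close>

lemma vdw_finite_colours:
  assumes "vdw B P" "finite E"
  shows "\<exists>X K. finite X \<and> X \<subseteq> B \<and> (\<forall>col :: 'a::ab_group_add \<Rightarrow> 'e. (\<forall>v. col v \<in> E) \<longrightarrow>
        (\<exists>x\<in>X. \<exists>k\<in>{1..K}. \<forall>p\<in>P. col (x + p k) = col x))"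
proof -
  obtain g where g: "bij_betw g E {0..<card E}"
    using ex_bij_betw_finite_nat[OF assms(2)] by blast
  obtain X K where X: "finite X" "X \<subseteq> B" and
    *: "\<And>col. (\<forall>v. col v < card E) \<Longrightarrow> \<exists>x\<in>X. \<exists>k\<in>{1..K}. \<forall>p\<in>P. col (x + p k) = col x"
    using assms(1) unfolding vdw_def by metis
  have "\<exists>x\<in>X. \<exists>k\<in>{1..K}. \<forall>p\<in>P. col (x + p k) = col x" if c: "\<forall>v. col v \<in> E"
    for col :: "'a \<Rightarrow> 'e"
  proof -
    have "\<forall>v. (g \<circ> col) v < card E"
      using g c by (auto simp: bij_betw_def)
    from *[OF this] have "\<exists>x\<in>X. \<exists>k\<in>{1..K}. \<forall>p\<in>P. g (col (x + p k)) = g (col x)"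
      by simp
    then show ?thesis
      using bij_betw_imp_inj_on[OF g] c unfolding inj_on_def by metis
  qed
  then show ?thesis using X by blast
qed

text \<open>Colour focusing: \<open>G\<close> collects the colours of the spokes \<open>{x + p k | p \<in> P}\<close> focused at \<open>x\<close>.\<close>

lemma vdw_focusing:
  fixes P :: "(nat \<Rightarrow> 'a::ab_group_add) set"
  assumes B: "add_subgroup B" and P: "finite P" "\<forall>p\<in>P. p 0 = 0 \<and> range p \<subseteq> B"
    and c: "range c \<subseteq> B"
    and IH: "\<And>N. vdw B ((\<lambda>(p, h) k. p (k + h) - p h - c k) ` (P \<times> {..N}))"
  shows "\<exists>X K. finite X \<and> X \<subseteq> B \<and> (\<forall>col :: 'a \<Rightarrow> nat. (\<forall>v. col v < r) \<longrightarrow>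
     (\<exists>x\<in>X. \<exists>k\<in>{1..K}. \<forall>p\<in>P. col (x + p k) = col x) \<or>
     (\<exists>x\<in>X. \<exists>G. card G = s \<and> G \<subseteq> {..<r} \<and>
        (\<forall>g\<in>G. \<exists>k\<in>{1..K}. \<forall>p\<in>P. col (x + p k) = g)))"
proof (induction s)
  case 0
  have "0 \<in> B" using B by (simp add: add_subgroup_def)
  then show ?case by (intro exI[of _ "{0}"] exI[of _ 0]) auto
next
  case (Suc s)
  then obtain X K where X: "finite X" "X \<subseteq> B" and
    foc: "\<And>col :: 'a \<Rightarrow> nat. (\<forall>v. col v < r) \<Longrightarrow>
     (\<exists>x\<in>X. \<exists>k\<in>{1..K}. \<forall>p\<in>P. col (x + p k) = col x) \<or>
     (\<exists>x\<in>X. \<exists>G. card G = s \<and> G \<subseteq> {..<r} \<and>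
        (\<forall>g\<in>G. \<exists>k\<in>{1..K}. \<forall>p\<in>P. col (x + p k) = g))"
    by blast
  \<comment> \<open>The window holds every possible focus together with all points of its
    spokes.\<close>
  define W where "W = X \<union> (\<lambda>(x, p, k). x + p k) ` (X \<times> P \<times> {..K})"
  have "finite W" using X P by (simp add: W_def)
  then have fin: "finite (PiE W (\<lambda>_. {..<r}))" by (simp add: finite_PiE)
  obtain Y L where Y: "finite Y" "Y \<subseteq> B" and
    win: "\<forall>col :: 'a \<Rightarrow> 'a \<Rightarrow> nat. (\<forall>v. col v \<in> PiE W (\<lambda>_. {..<r})) \<longrightarrow>
       (\<exists>y\<in>Y. \<exists>k\<in>{1..L}. \<forall>q\<in>((\<lambda>(p, h) k. p (k + h) - p h - c k) ` (P \<times> {..K})).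
          col (y + q k) = col y)"
    using vdw_finite_colours[OF IH[of K] fin] by (elim exE conjE) (rule that)
  \<comment> \<open>Either the old focus is translated by \<open>y\<close>, or the new focus
    \<open>y + x - c k\<close> is used, which gains one spoke.\<close>
  define Z where "Z = (\<lambda>(y, x). y + x) ` (Y \<times> X) \<union> (\<lambda>(y, x, k). y + x - c k) ` (Y \<times> X \<times> {..L})"
  have "finite Z" using X Y by (simp add: Z_def)
  moreover have "Z \<subseteq> B"
    using X(2) Y(2) c unfolding Z_def
    by (auto intro!: add_subgroup_add[OF B] add_subgroup_diff[OF B])
  moreover have "(\<exists>x\<in>Z. \<exists>k\<in>{1..K+L}. \<forall>p\<in>P. col (x + p k) = col x) \<or>
     (\<exists>x\<in>Z. \<exists>G. card G = Suc s \<and> G \<subseteq> {..<r} \<and>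
        (\<forall>g\<in>G. \<exists>k\<in>{1..K+L}. \<forall>p\<in>P. col (x + p k) = g))"
    if col: "\<forall>v. col v < r" for col :: "'a \<Rightarrow> nat"
  proof -
    have "\<forall>y. restrict (\<lambda>w. col (y + w)) W \<in> PiE W (\<lambda>_. {..<r})" using col by auto
    from win[THEN spec, THEN mp, OF this] obtain y k where y: "y \<in> Y" and k: "k \<in> {1..L}" and
      eq: "\<forall>q\<in>(\<lambda>(p, h) k. p (k + h) - p h - c k) ` (P \<times> {..K}).
        restrict (\<lambda>w. col (y + q k + w)) W = restrict (\<lambda>w. col (y + w)) W"
      by (elim bexE) (rule that)
    have eq: "col (y + (p (k + h) - p h - c k) + w) = col (y + w)"
      if "p \<in> P" "h \<le> K" "w \<in> W" for p h w
    proof -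
      have "(\<lambda>k. p (k + h) - p h - c k) \<in> (\<lambda>(p, h) k. p (k + h) - p h - c k) ` (P \<times> {..K})"
        using that by (intro image_eqI[of _ _ "(p, h)"]) auto
      from bspec[OF eq this] show ?thesis using that(3) by (auto dest: fun_cong[of _ _ w])
    qed
    from foc[of "\<lambda>v. col (y + v)"] col
    consider (a) x k where "x \<in> X" "k \<in> {1..K}" "\<forall>p\<in>P. col (y + (x + p k)) = col (y + x)"
      | (b) x G where "x \<in> X" "card G = s" "G \<subseteq> {..<r}"
        "\<forall>g\<in>G. \<exists>k\<in>{1..K}. \<forall>p\<in>P. col (y + (x + p k)) = g"
      by blast
    then show ?thesis
    proof cases
      case a
      then have "y + x \<in> Z" "k \<in> {1..K+L}" using y by (auto simp: Z_def)
      then show ?thesis using a by (metis add.assoc)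
    next
      case b
      show ?thesis
      proof (cases "col (y + x) \<in> G")
        case True
        then obtain k where "k \<in> {1..K}" "\<forall>p\<in>P. col (y + (x + p k)) = col (y + x)"
          using b by blast
        moreover have "y + x \<in> Z" using y b by (auto simp: Z_def)
        ultimately show ?thesis
          by (intro disjI1 bexI[of _ "y + x"] bexI[of _ k]) (auto simp: add.assoc)
      next
        case False
        let ?z = "y + x - c k" and ?G = "insert (col (y + x)) G"
        have "?z \<in> Z" using y k b by (force simp: Z_def)
        moreover have "card ?G = Suc s"
          using False b finite_subset[OF b(3)] by simp
        moreover have "?G \<subseteq> {..<r}" using b col by auto
        moreover have "\<exists>k\<in>{1..K+L}. \<forall>p\<in>P. col (?z + p k) = g" if "g \<in> ?G" for g
        proof (cases "g \<in> G")
          case True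
          then obtain j where j: "j \<in> {1..K}" "\<forall>p\<in>P. col (y + (x + p j)) = g" using b by blast
          \<comment> \<open>An old spoke survives with step \<open>k + j\<close>:
            \<open>?z + p (k + j)\<close> is \<open>x + p j\<close> translated by
            \<open>y + (p (k + j) - p j - c k)\<close>, and this window repeats the pattern at
            \<open>y\<close>.\<close>
          have "col (?z + p (k + j)) = g" if p: "p \<in> P" for p
          proof -
            have "x + p j \<in> W" using b j p by (force simp: W_def)
            then show ?thesis using eq[OF p, of j "x + p j"] j p by (simp add: algebra_simps)
          qed
          then show ?thesis using j k by (intro bexI[of _ "k + j"]) auto
        next
          case False
          then have g: "g = col (y + x)" using that by simp
          \<comment> \<open>The new spoke has step \<open>k\<close>: since \<open>p 0 = 0\<close>,
            its points are copies of the old focus \<open>x\<close> in the repeated window.\<close>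
          have "col (?z + p k) = g" if p: "p \<in> P" for p
          proof -
            have "x \<in> W" "p 0 = 0" using b p P(2) by (auto simp: W_def)
            then show ?thesis using eq[OF p, of 0 x] g by (simp add: algebra_simps)
          qed
          then show ?thesis using k by (intro bexI[of _ k]) auto
        qed
        ultimately show ?thesis by blast
      qed
    qed
  qed
  ultimately show ?case by blast
qed

text \<open>Once the spokes show all \<open>r\<close> colours, one of them has the colour of the
  focus.\<close>

lemma vdw_step:
  fixes P :: "(nat \<Rightarrow> 'a::ab_group_add) set"
  assumes "add_subgroup B" "finite P" "\<forall>p\<in>P. p 0 = 0 \<and> range p \<subseteq> B" "range c \<subseteq> B"
    and "\<And>N. vdw B ((\<lambda>(p, h) k. p (k + h) - p h - c k) ` (P \<times> {..N}))"
  shows "vdw B P"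
  unfolding vdw_def
proof
  fix r
  obtain X K where X: "finite X" "X \<subseteq> B" and
    foc: "\<And>col :: 'a \<Rightarrow> nat. (\<forall>v. col v < r) \<Longrightarrow>
     (\<exists>x\<in>X. \<exists>k\<in>{1..K}. \<forall>p\<in>P. col (x + p k) = col x) \<or>
     (\<exists>x\<in>X. \<exists>G. card G = r \<and> G \<subseteq> {..<r} \<and>
        (\<forall>g\<in>G. \<exists>k\<in>{1..K}. \<forall>p\<in>P. col (x + p k) = g))"
    using vdw_focusing[OF assms, of r r] by blast
  have "\<exists>x\<in>X. \<exists>k\<in>{1..K}. \<forall>p\<in>P. col (x + p k) = col x" if col: "\<forall>v. col v < r"
    for col :: "'a \<Rightarrow> nat"
  proof -
    have "G = {..<r}" if "card G = r" "G \<subseteq> {..<r}" for G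
      using card_subset_eq[OF _ that(2)] that(1) by simp
    then show ?thesis using foc[OF col] col by blast
  qed
  then show "\<exists>X K. finite X \<and> X \<subseteq> B \<and> (\<forall>col :: 'a \<Rightarrow> nat. (\<forall>v. col v < r) \<longrightarrow>
        (\<exists>x\<in>X. \<exists>k\<in>{1..K}. \<forall>p\<in>P. col (x + p k) = col x))"
    using X by blast
qed

section \<open>PET induction\<close>

lemma vdw_insert_zero: "vdw B (P - {\<lambda>_. 0}) \<Longrightarrow> vdw B P"
proof -
  have "(\<forall>p\<in>P. col (x + p k) = col x) \<longleftrightarrow> (\<forall>p\<in>P - {\<lambda>_. 0}. col (x + p k) = col x)"
    for col :: "'a \<Rightarrow> nat" and x k by (auto simp: fun_eq_iff)
  then show "vdw B (P - {\<lambda>_. 0}) \<Longrightarrow> vdw B P" unfolding vdw_def by presburger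
qed

text \<open>The bound is inclusive here, unlike in \<open>dpoly\<close>. Without a constant term,
  degree 0 forces the zero function, and this is where the PET induction ends.\<close>

definition polz :: "nat \<Rightarrow> (nat \<Rightarrow> 'a::ab_group_add) \<Rightarrow> bool" where
  "polz e p \<longleftrightarrow> dpoly (Suc e) p \<and> p 0 = 0"

lemma polz_zero: "polz e (\<lambda>k. 0)"
  by (simp add: polz_def dpoly_zero)

lemma polz_0: "polz 0 p \<Longrightarrow> p = (\<lambda>k. 0)"
  by (auto simp: polz_def fun_eq_iff) (metis add_0)

lemma polz_mono: "polz e p \<Longrightarrow> e \<le> e' \<Longrightarrow> polz e' p"
  unfolding polz_def using dpoly_mono Suc_le_mono by blast

lemma polz_add: "polz e p \<Longrightarrow> polz e q \<Longrightarrow> polz e (\<lambda>k. p k + q k)"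
  unfolding polz_def using dpoly_add[of "Suc e" p q] by simp

lemma polz_diff: "polz e p \<Longrightarrow> polz e q \<Longrightarrow> polz e (\<lambda>k. p k - q k)"
  unfolding polz_def using dpoly_diff[of "Suc e" p q] by simp

text \<open>Taking a difference costs one degree; subtracting the constant \<open>p h\<close>
  restores the value 0 at 0.\<close>

lemma polz_derivative:
  assumes "polz (Suc e) p" shows "polz e (\<lambda>k. p (k + h) - p h - p k)"
proof -
  have "dpoly (Suc e) (\<lambda>k. p (k + h) - p k)"
    using assms unfolding polz_def dpoly.simps(2)[of "Suc e"] by blast
  then have "dpoly (Suc e) (\<lambda>k. (p (k + h) - p k) - p h)" using dpoly_diff dpoly_const by blast
  then show ?thesis using assms by (simp add: polz_def algebra_simps)
qed

text \<open>
  PET induction. The family \<open>P\<close> is covered by the classes \<open>(c, e) \<in># C\<close>, where \<open>c\<close> has degree at most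
  \<open>e + 1\<close> and the members of the class differ from \<open>c\<close> by polynomials of degree at most \<open>e\<close>. Focusing
  along a centre \<open>c\<close> of minimal degree replaces its class by finitely many classes of smaller degree
  and keeps the degrees of all others.
\<close>

lemma polynomial_vdw_classes:
  fixes P :: "(nat \<Rightarrow> 'a::ab_group_add) set"
  assumes B: "add_subgroup B"
  shows "finite P \<Longrightarrow> (\<And>p k. p \<in> P \<Longrightarrow> p k \<in> B) \<Longrightarrow>
     (\<And>c e k. (c, e) \<in># C \<Longrightarrow> polz (Suc e) c \<and> c k \<in> B) \<Longrightarrow>
     (\<And>p. p \<in> P \<Longrightarrow> p \<noteq> (\<lambda>_. 0) \<Longrightarrow> \<exists>(c, e)\<in>set_mset C. polz e (\<lambda>k. p k - c k)) \<Longrightarrow>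
     M = image_mset snd C \<Longrightarrow> vdw B P"
proof (induction M arbitrary: C P rule: wf_induct_rule[OF wf_mult[OF wf_less_than]])
  case (1 M)
  note P = 1(2,3) and C = 1(4) and cov = 1(5) and M = 1(6)
  show ?case
  proof (cases "C = {#}")
    case True
    then have "P - {\<lambda>_. 0} = {}" using cov by auto
    moreover have "vdw B {}"
      unfolding vdw_def using B
      by (intro allI exI[of _ "{0}"] exI[of _ 1]) (auto simp: add_subgroup_def)
    ultimately show ?thesis by (metis vdw_insert_zero)
  next
    case False
    define e where "e = Min (snd ` set_mset C)"
    have "e \<in> snd ` set_mset C" unfolding e_def using False by (intro Min_in) auto
    then obtain c where ce: "(c, e) \<in># C" by force
    have min: "e \<le> e'" if "(c', e') \<in># C" for c' e'
      unfolding e_def using that by (intro Min_le) force+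
    have c: "polz (Suc e) c" "\<And>k. c k \<in> B" using C[OF ce] by auto
    have pos: "\<exists>e. polz e p" if "p \<in> P" for p
    proof (cases "p = (\<lambda>_. 0)")
      case True
      then show ?thesis using polz_zero by blast
    next
      case False
      then obtain c' e' where *: "(c', e') \<in># C" "polz e' (\<lambda>k. p k - c' k)" using cov \<open>p \<in> P\<close> by blast
      then have "polz (Suc e') (\<lambda>k. (p k - c' k) + c' k)"
        using C polz_mono[of e' _ "Suc e'"] by (intro polz_add) auto
      then show ?thesis by auto
    qed
    let ?P = "P - {\<lambda>_. 0}"
    have "vdw B ?P"
    proof (rule vdw_step[where c = c, OF B])
      show "finite ?P" using P by simp
      show "\<forall>p\<in>?P. p 0 = 0 \<and> range p \<subseteq> B" using pos P(2) unfolding polz_def by blast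
      show "range c \<subseteq> B" using c(2) by blast
      fix N
      let ?Q = "(\<lambda>(p, h) k. p (k + h) - p h - c k) ` (?P \<times> {..N})"
      \<comment> \<open>\<open>R\<close> contains all new polynomials arising from the class of
        \<open>c\<close>. Each member becomes the centre of its own class in \<open>E\<close>; if
        \<open>e = 0\<close>, they all vanish and need no class. The other centres are shifted by
        \<open>c\<close> in \<open>D'\<close>.\<close>
      define R where "R = {q \<in> ?Q. polz e q}"
      define D where "D = C - {#(c, e)#}"
      define D' where "D' = image_mset (\<lambda>(c', e'). (\<lambda>k. c' k - c k, e')) D"
      define E where "E = (if e = 0 then {#} else image_mset (\<lambda>q. (q, e - 1)) (mset_set R))"
      have finQ: "finite ?Q" using P by auto
      then have finR: "finite R" by (simp add: R_def)
      have QB: "q k \<in> B" if "q \<in> ?Q" for q k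
        using that P c(2) by (auto intro!: add_subgroup_diff[OF B])
      have CD: "C = add_mset (c, e) D" using ce by (simp add: D_def)
      show "vdw B ?Q"
      proof (rule 1(1)[of "image_mset snd (D' + E)" _ "D' + E"])
        have "image_mset snd D' = image_mset snd D"
          by (simp add: D'_def multiset.map_comp comp_def case_prod_beta)
        moreover have "\<forall>x. x \<in># image_mset snd E \<longrightarrow> x < e"
          by (auto simp: E_def)
        \<comment> \<open>One occurrence of \<open>e\<close> is exchanged for finitely many smaller
          degrees, a descent in the multiset order.\<close>
        ultimately have "(image_mset snd (D' + E), M) \<in> mult1 less_than"
          unfolding M CD by (intro mult1I[of _ e "image_mset snd D" _ "image_mset snd E"]) auto
        then show "(image_mset snd (D' + E), M) \<in> mult less_than"
          by (auto simp: mult_def)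
        show "finite ?Q" by (fact finQ)
        show "q k \<in> B" if "q \<in> ?Q" for q k using QB that by blast
        show "polz (Suc e') c' \<and> c' k \<in> B" if "(c', e') \<in># D' + E" for c' e' k
        proof (cases "(c', e') \<in># D'")
          case True
          then obtain c'' where *: "(c'', e') \<in># C" "c' = (\<lambda>k. c'' k - c k)"
            by (auto simp: D'_def CD)
          \<comment> \<open>Minimality of \<open>e\<close> enters here: subtracting \<open>c\<close>
            does not raise the degree of another centre.\<close>
          have "polz (Suc e') c" using min[OF *(1)] polz_mono[OF c(1), of "Suc e'"] by simp
          moreover have "polz (Suc e') c''" "c'' k \<in> B" using C[OF *(1)] by auto
          ultimately show ?thesis
            using *(2) c(2)[of k] polz_diff[of "Suc e'" c'' c] add_subgroup_diff[OF B] by simp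
        next
          case False
          then have "e \<noteq> 0" "c' \<in> R" "e' = e - 1"
            using that finR by (auto simp: E_def split: if_splits)
          then show ?thesis using QB by (auto simp: R_def)
        qed
        show "\<exists>(c', e')\<in>set_mset (D' + E). polz e' (\<lambda>k. q k - c' k)"
          if q: "q \<in> ?Q" "q \<noteq> (\<lambda>_. 0)" for q
        proof -
          obtain p h where p: "p \<in> P" "p \<noteq> (\<lambda>_. 0)" and qp: "q = (\<lambda>k. p (k + h) - p h - c k)"
            using q by auto
          obtain c' e' where c': "(c', e') \<in># C" and pc: "polz e' (\<lambda>k. p k - c' k)"
            using cov p by blast
          have "polz (Suc e') (\<lambda>k. (p k - c' k) + c' k)"
            using C[OF c'] polz_mono[OF pc] by (intro polz_add) auto
          \<comment> \<open>The shift by \<open>h\<close> changes \<open>p\<close> only by a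
            polynomial of degree at most \<open>e'\<close>, so \<open>q\<close> stays in the class
            of the shifted centre.\<close>
          then have "polz e' (\<lambda>k. (p (k + h) - p h - p k) + (p k - c' k))"
            using pc by (intro polz_add polz_derivative) simp_all
          then have qc: "polz e' (\<lambda>k. q k - (c' k - c k))" by (simp add: qp)
          show ?thesis
          proof (cases "(c', e') \<in># D")
            case True
            then have "(\<lambda>k. c' k - c k, e') \<in># D'" by (force simp: D'_def)
            then show ?thesis using qc by force
          next
            case False
            then have "c' = c" "e' = e" using c' by (auto simp: CD)
            then have "polz e q" using qc by simp
            moreover have "e \<noteq> 0" using \<open>polz e q\<close> q(2) polz_0[of q] by (cases "e = 0") auto
            ultimately have "(q, e - 1) \<in># E" using finR q by (auto simp: E_def R_def)
            then show ?thesis using polz_zero[of "e - 1"] by force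
          qed
        qed
        show "image_mset snd (D' + E) = image_mset snd (D' + E)" ..
      qed
    qed
    then show ?thesis by (rule vdw_insert_zero)
  qed
qed

theorem polynomial_vdw:
  assumes "add_subgroup B" "finite P" "\<And>p k. p \<in> P \<Longrightarrow> p k \<in> B"
    and "\<And>p. p \<in> P \<Longrightarrow> p 0 = 0" "\<And>p. p \<in> P \<Longrightarrow> \<exists>e. dpoly e p"
  shows "vdw B P"
proof -
  have "\<exists>e. polz (Suc e) p" if p: "p \<in> P" for p
    unfolding polz_def using assms(4,5)[OF p] dpoly_mono_Suc by blast
  then obtain d where d: "\<And>p. p \<in> P \<Longrightarrow> polz (Suc (d p)) p" by metis
  \<comment> \<open>Initially every polynomial is the centre of its own class.\<close>
  let ?C = "image_mset (\<lambda>p. (p, d p)) (mset_set P)"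
  show ?thesis
  proof (rule polynomial_vdw_classes[OF assms(1), where C = ?C and M = "image_mset snd ?C"])
    show "finite P" "\<And>p k. p \<in> P \<Longrightarrow> p k \<in> B" using assms(2,3) by auto
    show "polz (Suc e) c \<and> c k \<in> B" if "(c, e) \<in># ?C" for c e k
      using that d assms(2,3) by auto
    show "\<exists>(c, e)\<in>set_mset ?C. polz e (\<lambda>k. p k - c k)" if "p \<in> P" "p \<noteq> (\<lambda>_. 0)" for p
      using that assms(2) polz_zero[of "d p"] by (intro bexI[of _ "(p, d p)"]) auto
  qed auto
qed

section \<open>Rows of Deuber sets\<close>

text \<open>Defined by differences, this includes integer-valued polynomials with fractional
  coefficients, such as n(n-1)/2.\<close>

definition polys :: "(nat \<Rightarrow> int ^ 'd::finite) set" where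
  "polys = {h. h 0 = 0 \<and> (\<exists>e. dpoly e h)}"

lemma polys_add:
  assumes "g \<in> polys" "h \<in> polys" shows "(\<lambda>n. g n + h n) \<in> polys"
proof -
  obtain d e where "dpoly d g" "dpoly e h" using assms by (auto simp: polys_def)
  then have "dpoly (max d e) g" "dpoly (max d e) h" by (auto elim: dpoly_mono)
  then show ?thesis using assms dpoly_add by (fastforce simp: polys_def)
qed

lemma polys_minus: "h \<in> polys \<Longrightarrow> (\<lambda>n. - h n) \<in> polys"
  using dpoly_minus by (fastforce simp: polys_def)

lemma add_subgroup_polys: "add_subgroup (polys :: (nat \<Rightarrow> int ^ 'd::finite) set)"
proof -
  have "(0 :: nat \<Rightarrow> int ^ 'd) \<in> polys"
    using dpoly_zero by (auto simp: polys_def zero_fun_def)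
  moreover have "g + h \<in> polys" "g - h \<in> polys" if "g \<in> polys" "h \<in> polys" for g h :: "nat \<Rightarrow> int ^ 'd"
    using polys_add[OF that] polys_add[OF that(1) polys_minus[OF that(2)]]
    by (simp_all add: plus_fun_def fun_diff_def)
  ultimately show ?thesis by (simp add: add_subgroup_def)
qed

lemma polys_dilate: "h \<in> polys \<Longrightarrow> (\<lambda>n. h (k * n)) \<in> polys"
  unfolding polys_def using dpoly_dilate[of _ h k] by (auto simp: mult.commute)

lemma polys_linear: "(\<lambda>n. of_nat n *s v) \<in> (polys :: (nat \<Rightarrow> int ^ 'd::finite) set)"
proof -
  have "dpoly 2 (\<lambda>n. of_nat n *s v)"
    by (simp add: numeral_2_eq_2 vec.scale_left_distrib)
  then show ?thesis by (auto simp: polys_def)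
qed

text \<open>By induction the increments \<open>p (n + 1) - p n\<close> have a period
  \<open>T\<close> modulo \<open>a\<close>. Hence \<open>p (n + T) - p n\<close> is a constant
  \<open>g\<close> modulo \<open>a\<close>, and repeating this step as often as the absolute value
  of \<open>a\<close> yields a multiple of \<open>a\<close>.\<close>

lemma dpoly_periodic_mod:
  fixes p :: "nat \<Rightarrow> int ^ 'd::finite"
  assumes "a \<noteq> 0"
  shows "dpoly e p \<Longrightarrow> \<exists>T\<ge>1. \<forall>n. \<exists>w. p (n + T) - p n = a *s w"
proof (induction e arbitrary: p)
  case 0
  then show ?case by (intro exI[of _ 1]) (auto intro!: exI[of _ 0])
next
  case (Suc e)
  then obtain T where T: "T \<ge> 1" and "\<forall>n. \<exists>w. (p (n + T + 1) - p (n + T)) - (p (n + 1) - p n) = a *s w"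
    by fastforce
  from choice[OF this(2)] obtain w where
    w: "\<And>n. (p (n + T + 1) - p (n + T)) - (p (n + 1) - p n) = a *s w n"
    by blast
  define g where "g = p T - p 0"
  have g: "\<exists>v. p (n + T) - p n = g + a *s v" for n
  proof (induction n)
    case 0
    show ?case by (intro exI[of _ 0]) (simp add: g_def)
  next
    case (Suc n)
    then obtain v where "p (n + T) - p n = g + a *s v" by blast
    then have "p (Suc n + T) - p (Suc n) = g + a *s (v + w n)"
      using w[of n] by (simp add: vec.scale_right_distrib algebra_simps)
    then show ?case by blast
  qed
  have "\<exists>v. p (n + j * T) - p n = of_nat j *s g + a *s v" for n j
  proof (induction j)
    case 0
    show ?case by (intro exI[of _ 0]) simp
  next
    case (Suc j)
    then obtain v where v: "p (n + j * T) - p n = of_nat j *s g + a *s v" by blast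
    obtain u where "p (n + j * T + T) - p (n + j * T) = g + a *s u" using g by blast
    with v have "p (n + Suc j * T) - p n = of_nat (Suc j) *s g + a *s (u + v)"
      by (simp add: vec.scale_right_distrib vec.scale_left_distrib algebra_simps)
    then show ?case by blast
  qed
  then have "\<forall>n. \<exists>v. p (n + nat \<bar>a\<bar> * T) - p n = of_nat (nat \<bar>a\<bar>) *s g + a *s v" by blast
  from choice[OF this] obtain v where
    v: "\<And>n. p (n + nat \<bar>a\<bar> * T) - p n = of_nat (nat \<bar>a\<bar>) *s g + a *s v n"
    by blast
  \<comment> \<open>The factor \<open>sgn a\<close> turns the absolute value of \<open>a\<close>
    into a multiple of \<open>a\<close>.\<close>
  have period: "p (n + nat \<bar>a\<bar> * T) - p n = a *s (sgn a *s g + v n)" for n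
  proof -
    have "int (nat \<bar>a\<bar>) = a * sgn a" by (simp only: int_nat_eq abs_ge_zero if_True abs_sgn[symmetric])
    then show ?thesis using v[of n] by (simp add: vec.scale_right_distrib)
  qed
  have "nat \<bar>a\<bar> * T \<ge> 1" using assms T by (simp add: Suc_le_eq)
  then show ?case by (intro exI[of _ "nat \<bar>a\<bar> * T"] conjI allI) (assumption, rule exI, rule period)
qed

text \<open>Follows from periodicity modulo \<open>a\<close> and \<open>h 0 = 0\<close>. The choice
  \<open>b = a\<close> can fail because of denominators: n(n-1)/2 is odd at n = 2.\<close>

lemma polys_divisible:
  fixes h :: "nat \<Rightarrow> int ^ 'd::finite"
  assumes "a \<noteq> 0" "h \<in> polys"
  shows "\<exists>b\<ge>1. \<forall>n. \<exists>w. h (b * n) = a *s w"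
proof -
  obtain e where "dpoly e h" "h 0 = 0" using assms by (auto simp: polys_def)
  then obtain T where T: "T \<ge> 1" and "\<forall>n. \<exists>w. h (n + T) - h n = a *s w"
    using dpoly_periodic_mod[OF assms(1)] by blast
  from choice[OF this(2)] obtain w where w: "\<And>n. h (n + T) - h n = a *s w n" by blast
  have "\<exists>v. h (T * n) = a *s v" for n
  proof (induction n)
    case 0
    show ?case using \<open>h 0 = 0\<close> by (intro exI[of _ 0]) simp
  next
    case (Suc n)
    then obtain v where "h (T * n) = a *s v" by blast
    then have "h (T * Suc n) = a *s (v + w (T * n))"
      using w[of "T * n"] by (simp add: vec.scale_right_distrib algebra_simps)
    then show ?case by blast
  qed
  then show ?thesis using T by blast
qed

lemma polys_common_divisible:
  fixes H :: "(nat \<Rightarrow> int ^ 'd::finite) set"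
  assumes "a \<noteq> 0" "finite H" "H \<subseteq> polys"
  shows "\<exists>b\<ge>1. \<forall>h\<in>H. \<forall>n. \<exists>w. h (b * n) = a *s w"
  using assms(2,3)
proof (induction H)
  case (insert h H)
  then obtain b where b: "b \<ge> 1" "\<forall>h\<in>H. \<forall>n. \<exists>w. h (b * n) = a *s w" by auto
  obtain b' where b': "b' \<ge> 1" "\<forall>n. \<exists>w. h (b' * n) = a *s w"
    using polys_divisible[OF assms(1)] insert.prems by blast
  have "\<exists>w. g (b * b' * n) = a *s w" if "g \<in> insert h H" for g n
  proof (cases "g = h")
    case True
    then show ?thesis using b'(2)[rule_format, of "b * n"] by (simp add: ac_simps)
  next
    case False
    then show ?thesis using b(2)[rule_format, of g "b' * n"] that by (simp add: ac_simps)
  qed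
  moreover have "b * b' \<ge> 1" using b b' by simp
  ultimately show ?case by blast
qed auto

text \<open>
  Dilating by a suitable \<open>b\<close> makes all \<open>h \<in> H\<close> divisible by \<open>a\<close>, so that the van der Waerden theorem
  applies to the colouring of the multiples of \<open>a\<close>. The linear function \<open>l\<close> provides a second choice
  \<open>x + l(k n)\<close> in case that \<open>x n = 0\<close>.
\<close>

lemma row_vdw:
  fixes H :: "(nat \<Rightarrow> int ^ 'd::finite) set"
  assumes a: "a \<noteq> 0" and H: "finite H" "H \<subseteq> polys"
  shows "\<exists>X K. finite X \<and> X \<subseteq> polys \<and> (\<forall>n\<ge>1. \<forall>col :: int ^ 'd \<Rightarrow> nat. (\<forall>v. col v < r) \<longrightarrow>
     (\<exists>x\<in>X. \<exists>k\<in>{1..K}. x n \<noteq> 0 \<and> (\<exists>g. \<forall>h\<in>H. col (a *s x n + h (k * n)) = g)))"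
proof -
  obtain b where b: "b \<ge> 1" "\<And>h n. h \<in> H \<Longrightarrow> \<exists>w. h (b * n) = a *s w"
    using polys_common_divisible[OF a H] by blast
  then obtain q where q: "\<And>h n. h \<in> H \<Longrightarrow> h (b * n) = a *s q h n" by metis
  have qpol: "q h \<in> polys" if h: "h \<in> H" for h
  proof -
    have "(\<lambda>n. h (b * n)) \<in> polys" using h H polys_dilate by blast
    then obtain e where e: "dpoly e (\<lambda>n. a *s q h n)" "a *s q h 0 = 0"
      using q[OF h] by (auto simp: polys_def)
    have "dpoly e (\<lambda>n. a *s q h n) \<longleftrightarrow> dpoly e (q h)"
      by (rule dpoly_additive_iff[where g = "\<lambda>x. a *s x"])
        (use a in \<open>simp_all add: vec.scale_right_diff_distrib\<close>)
    then show ?thesis using e a by (auto simp: polys_def)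
  qed
  define l where "l = (\<lambda>n. of_nat n *s (1 :: int ^ 'd))"
  have l: "l \<in> polys" unfolding l_def by (rule polys_linear)
  \<comment> \<open>The sums \<open>q h + l\<close> keep the colours under control when the base
    point moves from \<open>x\<close> to \<open>x + l (k * n)\<close>.\<close>
  define Q where "Q = insert l (q ` H \<union> (\<lambda>h n. q h n + l n) ` H)"
  have Q: "finite Q" "Q \<subseteq> polys"
    using H qpol l by (auto simp: Q_def intro!: polys_add)
  have vdw: "vdw polys ((\<lambda>h k n. h (k * n)) ` Q)"
  proof (rule polynomial_vdw[OF add_subgroup_polys])
    show "finite ((\<lambda>h k n. h (k * n)) ` Q)" using Q by simp
    fix p :: "nat \<Rightarrow> nat \<Rightarrow> int ^ 'd" assume "p \<in> (\<lambda>h k n. h (k * n)) ` Q"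
    then obtain h where h: "h \<in> polys" "p = (\<lambda>k n. h (k * n))" using Q by auto
    show "p k \<in> polys" for k using h polys_dilate by auto
    show "p 0 = 0" using h by (auto simp: polys_def zero_fun_def)
    obtain e where "dpoly e h" using h by (auto simp: polys_def)
    then have "dpoly e p" unfolding h(2) by (subst dpoly_pointwise) (intro allI dpoly_dilate)
    then show "\<exists>e. dpoly e p" ..
  qed
  obtain X K where X: "finite X" "X \<subseteq> polys" and
    *: "\<forall>col. (\<forall>v. col v < r) \<longrightarrow>
      (\<exists>x\<in>X. \<exists>k\<in>{1..K}. \<forall>p\<in>(\<lambda>h k n. h (k * n)) ` Q. col (x + p k) = col x)"
    using vdw[unfolded vdw_def, THEN spec, of r] by (elim exE conjE) (rule that)
  define Y where "Y = X \<union> (\<lambda>(x, k) n. x n + l (k * n)) ` (X \<times> {1..K})"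
  have "finite Y" using X by (simp add: Y_def)
  moreover have "Y \<subseteq> polys" using X l by (auto simp: Y_def intro!: polys_add polys_dilate)
  moreover have good: "\<exists>x\<in>Y. \<exists>k\<in>{1..b * K}. x n \<noteq> 0 \<and> (\<exists>g. \<forall>h\<in>H. col (a *s x n + h (k * n)) = g)"
    if n: "n \<ge> 1" and col: "\<forall>v. col v < r" for n and col :: "int ^ 'd \<Rightarrow> nat"
  proof -
    \<comment> \<open>For fixed \<open>n\<close> a polynomial receives the colour of
      \<open>a\<close> times its value at \<open>n\<close>. \<open>X\<close> and \<open>K\<close>
      were chosen before this colouring, hence before \<open>n\<close> and
      \<open>col\<close>.\<close>
    obtain x k where x: "x \<in> X" and k: "k \<in> {1..K}" and
      xk: "\<forall>p\<in>(\<lambda>h k n. h (k * n)) ` Q. col (a *s (x + p k) n) = col (a *s x n)"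
      using *[THEN spec, of "\<lambda>h. col (a *s h n)"] col by (elim impE bexE) (blast, rule that)
    have xk: "col (a *s (x n + h (k * n))) = col (a *s x n)" if "h \<in> Q" for h
      using bspec[OF xk imageI[OF that]] by simp
    have 1: "\<forall>h\<in>H. col (a *s (x n + q h (k * n))) = col (a *s x n)"
      and 2: "\<forall>h\<in>H. col (a *s (x n + (q h (k * n) + l (k * n)))) = col (a *s x n)"
      using xk[of "\<lambda>n. q h n + l n" for h] xk by (auto simp: Q_def)
    \<comment> \<open>A dilation by \<open>k\<close> for the quotient \<open>q h\<close> is a
      dilation by \<open>b * k\<close> for \<open>h\<close>.\<close>
    have hq: "h (b * k * n) = a *s q h (k * n)" if "h \<in> H" for h
      using q[OF that, of "k * n"] by (simp add: mult.assoc)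
    have bk: "b * k \<in> {1..b * K}" using b k by (simp add: Suc_le_eq)
    show ?thesis
    proof (cases "x n = 0")
      case False
      have "\<forall>h\<in>H. col (a *s x n + h (b * k * n)) = col (a *s x n)"
        using 1 hq by (simp add: vec.scale_right_distrib)
      then show ?thesis using x bk False unfolding Y_def by blast
    next
      case True
      let ?x = "\<lambda>n. x n + l (k * n)"
      have "\<forall>h\<in>H. col (a *s ?x n + h (b * k * n)) = col (a *s x n)"
        using 2 hq by (simp add: vec.scale_right_distrib algebra_simps)
      moreover have "?x n \<noteq> 0" using True n k by (simp add: l_def vec_eq_iff)
      moreover have "?x \<in> Y" using x k by (force simp: Y_def)
      ultimately show ?thesis using bk
        by (intro bexI[of _ ?x] bexI[of _ "b * k"] conjI exI[of _ "col (a *s x n)"])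
    qed
  qed
  ultimately show ?thesis
    by (intro exI[of _ Y] exI[of _ "b * K"] conjI allI impI good) (assumption | erule spec)+
qed

section \<open>Induction over the rows\<close>

text \<open>This is all that the induction uses of a polynomial map fixing the origin; it passes
  easily to maps read along subsequences of the arguments.\<close>

definition admissible :: "nat \<Rightarrow> ((nat \<Rightarrow> int ^ 'd::finite) \<Rightarrow> int ^ 'd) \<Rightarrow> bool" where
  "admissible i f \<longleftrightarrow> (\<forall>s t. (\<forall>j<i. s j = t j) \<longrightarrow> f s = f t) \<and>
     (\<forall>s. (\<forall>j. s j \<in> polys) \<longrightarrow> (\<lambda>n. f (\<lambda>j. s j n)) \<in> polys)"

lemma admissible_cong: "admissible i f \<Longrightarrow> (\<And>j. j < i \<Longrightarrow> s j = t j) \<Longrightarrow> f s = f t"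
  by (simp add: admissible_def)

lemma admissible_polys: "admissible i f \<Longrightarrow> (\<And>j. s j \<in> polys) \<Longrightarrow> (\<lambda>n. f (\<lambda>j. s j n)) \<in> polys"
  by (simp add: admissible_def)

text \<open>\<open>S\<close> must be finite so that the next row meets only finitely many
  polynomials, and uniform in \<open>n\<close> because the earlier rows will be evaluated at
  \<open>k * n\<close> with \<open>k\<close> known only afterwards.\<close>

lemma monochromatic_rows:
  fixes F :: "nat \<Rightarrow> ((nat \<Rightarrow> int ^ 'd::finite) \<Rightarrow> int ^ 'd) set"
  assumes a: "a \<noteq> 0"
  shows "\<forall>i\<le>M. finite (F i) \<and> (\<forall>f\<in>F i. admissible i f) \<Longrightarrow>
    \<exists>S. finite S \<and> (\<forall>s\<in>S. \<forall>j. s j \<in> polys) \<and>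
      (\<forall>n\<ge>1. \<forall>col :: int ^ 'd \<Rightarrow> nat. (\<forall>v. col v < r) \<longrightarrow>
        (\<exists>s\<in>S. \<forall>i\<le>M. s i n \<noteq> 0 \<and> (\<exists>g. \<forall>f\<in>F i. col (a *s s i n + f (\<lambda>j. s j n)) = g)))"
proof (induction M)
  case 0
  define l where "l = (\<lambda>n. of_nat n *s (1 :: int ^ 'd))"
  have l: "l \<in> polys" unfolding l_def by (rule polys_linear)
  \<comment> \<open>A map in row 0 reads no arguments, so it is constant, and polynomial sequences
    vanish at 0.\<close>
  have f: "f s = 0" if "f \<in> F 0" for f s
  proof -
    have ad: "admissible 0 f" using 0 that by simp
    have "f s = f (\<lambda>j. l 0)" using ad by (rule admissible_cong) simp
    also have "(\<lambda>n. f (\<lambda>j. l n)) \<in> polys" using ad l by (rule admissible_polys)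
    then have "f (\<lambda>j. l 0) = 0" by (simp add: polys_def)
    finally show ?thesis .
  qed
  have "l n \<noteq> 0" if "n \<ge> 1" for n using that by (simp add: l_def vec_eq_iff)
  moreover have "\<exists>g. \<forall>f\<in>F 0. col (a *s l n + f t) = g" for n t and col :: "int ^ 'd \<Rightarrow> nat"
    by (rule exI[of _ "col (a *s l n)"]) (simp add: f)
  ultimately show ?case using l by (intro exI[of _ "{\<lambda>_. l}"]) simp
next
  case (Suc M)
  have adm: "admissible i f" if "i \<le> Suc M" "f \<in> F i" for i f using Suc.prems that by blast
  have "\<forall>i\<le>M. finite (F i) \<and> (\<forall>f\<in>F i. admissible i f)" using Suc.prems by simp
  from Suc.IH[OF this] obtain S where S: "finite S" "\<forall>s\<in>S. \<forall>j. s j \<in> polys" and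
    IH: "\<forall>n\<ge>1. \<forall>col :: int ^ 'd \<Rightarrow> nat. (\<forall>v. col v < r) \<longrightarrow>
       (\<exists>s\<in>S. \<forall>i\<le>M. s i n \<noteq> 0 \<and> (\<exists>g. \<forall>f\<in>F i. col (a *s s i n + f (\<lambda>j. s j n)) = g))"
    by (elim exE conjE) (rule that)
  \<comment> \<open>The new row is solved for all candidates \<open>s\<close> at once, since the
    right one is determined only after \<open>x\<close> and \<open>k\<close>.\<close>
  define H where "H = (\<lambda>(s, f) n. f (\<lambda>j. s j n)) ` (S \<times> F (Suc M))"
  have "finite H" using S Suc.prems by (simp add: H_def)
  moreover have "H \<subseteq> polys"
  proof
    fix h assume "h \<in> H"
    then obtain s f where s: "s \<in> S" and f: "f \<in> F (Suc M)" and h: "h = (\<lambda>n. f (\<lambda>j. s j n))"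
      by (auto simp: H_def)
    show "h \<in> polys" unfolding h using adm[OF order_refl f] by (rule admissible_polys) (use S(2) s in blast)
  qed
  ultimately have "\<exists>X K. finite X \<and> X \<subseteq> polys \<and> (\<forall>n\<ge>1. \<forall>col :: int ^ 'd \<Rightarrow> nat. (\<forall>v. col v < r) \<longrightarrow>
     (\<exists>x\<in>X. \<exists>k\<in>{1..K}. x n \<noteq> 0 \<and> (\<exists>g. \<forall>h\<in>H. col (a *s x n + h (k * n)) = g)))"
    by (rule row_vdw[OF a])
  then obtain X K where X: "finite X" "X \<subseteq> polys" and
    row: "\<forall>n\<ge>1. \<forall>col :: int ^ 'd \<Rightarrow> nat. (\<forall>v. col v < r) \<longrightarrow>
     (\<exists>x\<in>X. \<exists>k\<in>{1..K}. x n \<noteq> 0 \<and> (\<exists>g. \<forall>h\<in>H. col (a *s x n + h (k * n)) = g))"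
    by (elim exE conjE) (rule that)
  define S' where "S' = (\<lambda>(s, k, x). (\<lambda>j n. s j (k * n))(Suc M := x)) ` (S \<times> {1..K} \<times> X)"
  have "finite S'" using S X by (simp add: S'_def)
  moreover have "\<forall>s\<in>S'. \<forall>j. s j \<in> polys"
    using S(2) X(2) by (auto simp: S'_def intro!: polys_dilate)
  moreover have good: "\<exists>s\<in>S'. \<forall>i\<le>Suc M. s i n \<noteq> 0 \<and> (\<exists>g. \<forall>f\<in>F i. col (a *s s i n + f (\<lambda>j. s j n)) = g)"
    if n: "n \<ge> 1" and col: "\<forall>v. col v < r" for n and col :: "int ^ 'd \<Rightarrow> nat"
  proof -
    obtain x k g where x: "x \<in> X" "x n \<noteq> 0" and k: "k \<in> {1..K}" and
      g: "\<And>h. h \<in> H \<Longrightarrow> col (a *s x n + h (k * n)) = g"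
      using row[rule_format, OF n, of col] col by blast
    have "k * n \<ge> 1" using k n by simp
    then obtain s where s: "s \<in> S" and
      good: "\<And>i. i \<le> M \<Longrightarrow> s i (k * n) \<noteq> 0 \<and>
        (\<exists>g. \<forall>f\<in>F i. col (a *s s i (k * n) + f (\<lambda>j. s j (k * n))) = g)"
      using IH[rule_format, of "k * n" col] col by blast
    define t where "t = (\<lambda>j n. s j (k * n))(Suc M := x)"
    have "t \<in> S'" using s k x by (force simp: S'_def t_def)
    moreover have "t i n \<noteq> 0 \<and> (\<exists>g. \<forall>f\<in>F i. col (a *s t i n + f (\<lambda>j. t j n)) = g)"
      if i: "i \<le> Suc M" for i
    proof -
      have ft: "f (\<lambda>j. t j n) = f (\<lambda>j. s j (k * n))" if "f \<in> F i" for f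
        using adm[OF i that] by (rule admissible_cong) (use i in \<open>simp add: t_def\<close>)
      show ?thesis
      proof (cases "i = Suc M")
        case True
        then have ti: "t i n = x n" by (simp add: t_def)
        have "col (a *s t i n + f (\<lambda>j. t j n)) = g" if f: "f \<in> F i" for f
        proof -
          have "(\<lambda>n. f (\<lambda>j. s j n)) \<in> H"
            unfolding H_def using s f True by (intro image_eqI[of _ _ "(s, f)"]) auto
          from g[OF this] show ?thesis by (simp only: ti ft[OF f])
        qed
        then show ?thesis using x(2) ti by auto
      next
        case False
        then have ti: "t i n = s i (k * n)" and "i \<le> M" using i by (simp_all add: t_def)
        then obtain g where "s i (k * n) \<noteq> 0"
          and g: "\<forall>f\<in>F i. col (a *s s i (k * n) + f (\<lambda>j. s j (k * n))) = g"
          using good by blast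
        have "col (a *s t i n + f (\<lambda>j. t j n)) = g" if f: "f \<in> F i" for f
          using bspec[OF g f] by (simp only: ti ft[OF f])
        then show ?thesis using ti \<open>s i (k * n) \<noteq> 0\<close> by auto
      qed
    qed
    ultimately show ?thesis by blast
  qed
  ultimately show ?case by (intro exI[of _ S'] conjI allI impI good) (assumption | erule spec)+
qed

section \<open>Polynomial maps are admissible\<close>

lemma dpoly_sum:
  assumes "finite A" "\<And>x. x \<in> A \<Longrightarrow> \<exists>e. dpoly e (g x)"
  shows "\<exists>e. dpoly e (\<lambda>k. \<Sum>x\<in>A. g x k)"
  using assms
proof (induction A)
  case empty
  then show ?case using dpoly_zero by auto
next
  case (insert x A)
  obtain d where "dpoly d (g x)" using insert.prems by blast
  moreover obtain e where "dpoly e (\<lambda>k. \<Sum>x\<in>A. g x k)" using insert by blast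
  ultimately have "dpoly (max d e) (\<lambda>k. g x k + (\<Sum>x\<in>A. g x k))"
    by (intro dpoly_add) (auto elim: dpoly_mono)
  then show ?case using insert by auto
qed

lemma dpoly_prod:
  fixes g :: "'b \<Rightarrow> nat \<Rightarrow> 'a::comm_ring_1"
  assumes "finite A" "\<And>x. x \<in> A \<Longrightarrow> \<exists>e. dpoly e (g x)"
  shows "\<exists>e. dpoly e (\<lambda>k. \<Prod>x\<in>A. g x k)"
  using assms
proof (induction A)
  case empty
  show ?case unfolding prod.empty by (rule exI, rule dpoly_const)
next
  case (insert x A)
  obtain d where "dpoly d (g x)" using insert.prems by blast
  moreover obtain e where "dpoly e (\<lambda>k. \<Prod>x\<in>A. g x k)" using insert by blast
  ultimately have "dpoly (d + e) (\<lambda>k. g x k * (\<Prod>x\<in>A. g x k))" by (rule dpoly_mult)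
  then show ?case using insert by auto
qed

lemma dpoly_power:
  fixes p :: "nat \<Rightarrow> 'a::comm_ring_1"
  assumes "\<exists>e. dpoly e p" shows "\<exists>e. dpoly e (\<lambda>k. p k ^ j)"
  using dpoly_prod[of "{..<j}" "\<lambda>_. p"] assms by simp

lemma dpoly_mpoly_eval:
  assumes "\<And>v. v \<in> mpoly_vars p \<Longrightarrow> \<exists>e. dpoly e (\<lambda>n. x n v)"
  shows "\<exists>e. dpoly e (\<lambda>n. mpoly_eval (p :: ('v, rat) mpolynomial) (x n))"
  unfolding mpoly_eval_def
proof (rule dpoly_sum)
  fix m assume m: "m \<in> Poly_Mapping.keys p"
  have "\<exists>e. dpoly e (\<lambda>n. \<Prod>v\<in>Poly_Mapping.keys m. x n v ^ Poly_Mapping.lookup m v)"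
    using m assms by (intro dpoly_prod dpoly_power) (auto simp: mpoly_vars_def)
  then show "\<exists>e. dpoly e (\<lambda>n. Poly_Mapping.lookup p m * (\<Prod>v\<in>Poly_Mapping.keys m. x n v ^ Poly_Mapping.lookup m v))"
    using dpoly_mult[OF dpoly_const] by blast
qed simp

lemma mpoly_eval_cong:
  assumes "\<And>v. v \<in> mpoly_vars p \<Longrightarrow> x v = y v"
  shows "mpoly_eval p x = mpoly_eval p y"
proof -
  have "x v = y v" if "m \<in> Poly_Mapping.keys p" "v \<in> Poly_Mapping.keys m" for m v
    using that by (intro assms) (auto simp: mpoly_vars_def)
  then show ?thesis unfolding mpoly_eval_def by (auto intro!: sum.cong prod.cong)
qed

text \<open>Substituting polynomial sequences into the rational polynomials gives polynomial
  sequences over the rationals; the differences of the integer values have the same degrees.\<close>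

lemma polynomial_map_admissible:
  fixes f :: "(nat \<Rightarrow> int ^ 'd::finite) \<Rightarrow> int ^ 'd"
  assumes f: "polynomial_map i f" and f0: "f (\<lambda>_. 0) = 0"
  shows "admissible i f"
proof -
  obtain p :: "'d \<Rightarrow> (nat \<times> 'd, rat) mpolynomial" where
    vars: "\<And>k. mpoly_vars (p k) \<subseteq> {..<i} \<times> UNIV" and
    p: "\<And>k s. of_int (f s $ k) = mpoly_eval (p k) (\<lambda>(j, l). of_int (s j $ l))"
    using f unfolding polynomial_map_def by metis
  have "f s = f t" if "\<forall>j<i. s j = t j" for s t
  proof -
    have "(of_int (f s $ k) :: rat) = of_int (f t $ k)" for k
      unfolding p using vars[of k] that by (intro mpoly_eval_cong) auto
    then show ?thesis by (simp add: vec_eq_iff)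
  qed
  moreover have "(\<lambda>n. f (\<lambda>j. s j n)) \<in> polys" if s: "\<forall>j. s j \<in> polys" for s
  proof -
    have int: "dpoly e (\<lambda>n. of_int (g n) :: rat) \<longleftrightarrow> dpoly e g" for e g
      by (rule dpoly_additive_iff[where g = of_int]) auto
    have "\<exists>e. dpoly e (\<lambda>n. f (\<lambda>j. s j n) $ k)" for k
    proof -
      have "\<exists>e. dpoly e (\<lambda>n. mpoly_eval (p k) (\<lambda>(j, l). of_int (s j n $ l)))"
      proof (rule dpoly_mpoly_eval)
        fix v :: "nat \<times> 'd"
        obtain j l where v: "v = (j, l)" by fastforce
        obtain e where "dpoly e (s j)" using s by (auto simp: polys_def)
        then have "dpoly e (\<lambda>n. of_int (s j n $ l) :: rat)" unfolding int using dpoly_vec by blast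
        then show "\<exists>e. dpoly e (\<lambda>n. case v of (j, l) \<Rightarrow> (of_int (s j n $ l) :: rat))"
          using v by auto
      qed
      then show ?thesis unfolding p[symmetric] int .
    qed
    then obtain d where d: "\<And>k. dpoly (d k) (\<lambda>n. f (\<lambda>j. s j n) $ k)" by metis
    \<comment> \<open>The finitely many coordinates share a degree bound.\<close>
    have "dpoly (Max (range d)) (\<lambda>n. f (\<lambda>j. s j n))"
      unfolding dpoly_vec[of "Max (range d)"] using dpoly_mono[OF d] by auto
    moreover have "f (\<lambda>j. s j 0) = 0" using s f0 by (simp add: polys_def)
    ultimately show ?thesis by (auto simp: polys_def)
  qed
  ultimately show ?thesis by (simp add: admissible_def)
qed

section \<open>Selecting rows of one colour\<close>

lemma admissible_reindex:
  assumes "admissible j f" "\<And>l. l < j \<Longrightarrow> \<iota> l < i"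
  shows "admissible i (\<lambda>s. f (\<lambda>l. s (\<iota> l)))"
  using assms unfolding admissible_def by simp

text \<open>Among \<open>r * m + 1\<close> indices some colour occurs more than \<open>m\<close>
  times; its indices are listed in increasing order.\<close>

lemma pigeonhole_increasing:
  fixes g :: "nat \<Rightarrow> nat"
  assumes "\<And>i. i \<le> r * m \<Longrightarrow> g i < r"
  shows "\<exists>\<iota>. strict_mono_on {..m} \<iota> \<and> (\<forall>j\<le>m. \<iota> j \<le> r * m \<and> g (\<iota> j) = g (\<iota> 0))"
proof -
  have "\<exists>y<r. m < card {i \<in> {..r * m}. g i = y}"
  proof (rule ccontr)
    assume "\<not> ?thesis"
    then have *: "card {i \<in> {..r * m}. g i = y} \<le> m" if "y < r" for y
      using that not_less by blast
    have "{..r * m} = (\<Union>y<r. {i \<in> {..r * m}. g i = y})" using assms by auto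
    then have "card {..r * m} = card (\<Union>y<r. {i \<in> {..r * m}. g i = y})" by (rule arg_cong)
    also have "\<dots> \<le> (\<Sum>y<r. card {i \<in> {..r * m}. g i = y})"
      by (rule card_UN_le) simp
    also have "\<dots> \<le> (\<Sum>y<r. m)" using * by (intro sum_mono) auto
    finally show False by simp
  qed
  then obtain y where y: "m < card {i \<in> {..r * m}. g i = y}" by blast
  define A where "A = {i \<in> {..r * m}. g i = y}"
  define xs where "xs = sorted_list_of_set A"
  have fin: "finite A" by (simp add: A_def)
  have len: "m < length xs" using y by (simp add: xs_def A_def)
  have inA: "xs ! j \<in> A" if "j \<le> m" for j
    using len that nth_mem[of j xs] fin by (simp add: xs_def)
  show ?thesis
  proof (intro exI conjI allI impI)
    show "strict_mono_on {..m} ((!) xs)"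
      using len strict_sorted_list_of_set[of A]
      by (auto simp: strict_mono_on_def xs_def intro: sorted_wrt_nth_less)
    show "xs ! j \<le> r * m" "g (xs ! j) = g (xs ! 0)" if "j \<le> m" for j
      using inA[OF that] inA[of 0] by (auto simp: A_def)
  qed
qed

theorem theorem1p8:
  fixes m :: nat
    and F :: "nat \<Rightarrow> ((nat \<Rightarrow> int ^ 'd::finite) \<Rightarrow> int ^ 'd) set"
    and c :: "int ^ 'd \<Rightarrow> int ^ 'd"
    and col :: "int ^ 'd \<Rightarrow> 'col"
  assumes "m \<ge> 1"
    and "\<And>i. i \<in> {1..m} \<Longrightarrow> finite (F i)"
    and "\<And>i f. i \<in> {1..m} \<Longrightarrow> f \<in> F i \<Longrightarrow> polynomial_map i f"
    and "\<And>i f. i \<in> {1..m} \<Longrightarrow> f \<in> F i \<Longrightarrow> f (\<lambda>_. 0) = 0"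
    and "scalar_hom c"
    and "finite (col ` UNIV)"
  shows "\<exists>s :: nat \<Rightarrow> int ^ 'd. (\<forall>j\<le>m. s j \<noteq> 0) \<and> monochromatic col (deuber_set m F c s)"
proof -
  obtain a where a: "a \<noteq> 0" and c: "\<And>x. c x = a *s x"
    using assms(5) unfolding scalar_hom_def by blast
  obtain enc where enc: "bij_betw enc (range col) {0..<card (range col)}"
    using ex_bij_betw_finite_nat[OF assms(6)] by blast
  define r where "r = card (range col)"
  define col' where "col' = enc \<circ> col"
  have col': "\<forall>v. col' v < r"
    using enc by (auto simp: col'_def r_def bij_betw_def)
  have col_eq: "col u = col v" if "col' u = col' v" for u v
    using bij_betw_imp_inj_on[OF enc] that by (auto simp: col'_def inj_on_def)
  define N where "N = r * m"
  define I where "I = PiE {..m} (\<lambda>_. {..N})"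
  \<comment> \<open>Row \<open>i\<close> anticipates every selection \<iota> in which the arguments
    of a map from some \<open>F j\<close> come from rows before \<open>i\<close>. The zero map puts
    \<open>a *s s i\<close> itself into the row.\<close>
  define F' where "F' i = insert (\<lambda>_. 0) (\<Union>j\<in>{1..m}.
     (\<lambda>(f, \<iota>) s. f (\<lambda>l. s (\<iota> l))) ` (F j \<times> {\<iota> \<in> I. \<forall>l<j. \<iota> l < i}))" for i
  have "finite I" unfolding I_def by (intro finite_PiE) auto
  then have fin: "finite (F' i)" for i using assms(2) by (auto simp: F'_def)
  have adm: "admissible i f" if f: "f \<in> F' i" for i f
  proof (cases "f = (\<lambda>_. 0)")
    case True
    then show ?thesis using add_subgroup_polys
      by (auto simp: admissible_def add_subgroup_def zero_fun_def)
  next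
    case False
    then obtain j g \<iota> where j: "j \<in> {1..m}" "g \<in> F j" and \<iota>: "\<forall>l<j. \<iota> l < i"
      and fg: "f = (\<lambda>s. g (\<lambda>l. s (\<iota> l)))"
      using f by (auto simp: F'_def)
    have "admissible j g" using polynomial_map_admissible assms(3,4) j by blast
    then show ?thesis unfolding fg using \<iota> admissible_reindex by blast
  qed
  have "\<forall>i\<le>N. finite (F' i) \<and> (\<forall>f\<in>F' i. admissible i f)" using fin adm by blast
  from monochromatic_rows[OF a this, of r] obtain S where S: "\<forall>n\<ge>(1::nat). \<forall>col :: int ^ 'd \<Rightarrow> nat. (\<forall>v. col v < r) \<longrightarrow>
        (\<exists>s\<in>S. \<forall>i\<le>N. s i n \<noteq> 0 \<and> (\<exists>g. \<forall>f\<in>F' i. col (a *s s i n + f (\<lambda>j. s j n)) = g))"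
    by (elim exE conjE) (rule that)
  \<comment> \<open>The parameter has served its purpose in the induction and is set to 1, turning
    the entries into vectors.\<close>
  obtain s where s: "\<And>i. i \<le> N \<Longrightarrow> s i (1::nat) \<noteq> 0 \<and>
      (\<exists>g. \<forall>f\<in>F' i. col' (a *s s i 1 + f (\<lambda>j. s j 1)) = g)"
    using S[THEN spec, THEN mp, THEN spec, THEN mp, OF order_refl col'] by blast
  define t where "t = (\<lambda>i. s i 1)"
  \<comment> \<open>The zero map identifies the colour of row \<open>i\<close> as that of
    \<open>a *s t i\<close>, so the pigeonhole can compare rows by these points.\<close>
  have row: "col' (a *s t i + f t) = col' (a *s t i)" if i: "i \<le> N" and f: "f \<in> F' i" for i f
  proof -
    obtain g where "\<forall>f\<in>F' i. col' (a *s t i + f t) = g" using s[OF i] unfolding t_def by blast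
    moreover have "(\<lambda>_. 0) \<in> F' i" by (simp add: F'_def)
    ultimately show ?thesis using f by force
  qed
  obtain \<iota> where mono: "strict_mono_on {..m} \<iota>" and le: "\<And>j. j \<le> m \<Longrightarrow> \<iota> j \<le> N"
    and same: "\<And>j. j \<le> m \<Longrightarrow> col' (a *s t (\<iota> j)) = col' (a *s t (\<iota> 0))"
    using pigeonhole_increasing[of r m "\<lambda>i. col' (a *s t i)"] col' unfolding N_def by blast
  define u where "u = (\<lambda>j. t (\<iota> j))"
  have "col' (a *s u j + f u) = col' (a *s u 0)" if j: "j \<in> {1..m}" and f: "f \<in> F j" for j f
  proof -
    \<comment> \<open>Membership in \<open>I\<close> requires \<open>undefined\<close> outside
      \<open>{..m}\<close>; \<open>f\<close> reads only arguments below \<open>j\<close>, where the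
      restriction changes nothing.\<close>
    let ?\<iota> = "restrict \<iota> {..m}"
    have "?\<iota> \<in> I" using le by (auto simp: I_def)
    moreover have "\<forall>l<j. ?\<iota> l < \<iota> j" using mono j by (auto simp: strict_mono_on_def)
    ultimately have "(\<lambda>s. f (\<lambda>l. s (?\<iota> l))) \<in> F' (\<iota> j)" unfolding F'_def using j f
      by (intro insertI2 UN_I[of j] image_eqI[of _ _ "(f, ?\<iota>)"]) auto
    then have "col' (a *s t (\<iota> j) + f (\<lambda>l. t (?\<iota> l))) = col' (a *s t (\<iota> j))"
      using row[of "\<iota> j"] le j by auto
    moreover have "f (\<lambda>l. t (?\<iota> l)) = f u"
    proof -
      have "admissible j f" using polynomial_map_admissible assms(3,4) j f by blast
      then show ?thesis by (rule admissible_cong) (use j in \<open>simp add: u_def\<close>)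
    qed
    ultimately show ?thesis using same[of j] j by (simp add: u_def)
  qed
  then have "\<forall>x\<in>deuber_set m F c u. col x = col (a *s u 0)"
    by (auto simp: deuber_set_def c add.commute intro!: col_eq)
  moreover have "\<forall>j\<le>m. u j \<noteq> 0" using s le by (simp add: u_def t_def)
  ultimately show ?thesis unfolding monochromatic_def by blast
qed

end
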